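(* Let $c,m>1$ be integers and let $L\geqslant 2$ be an integer with prime factorisation $L=p_1^{n_1}p_2^{n_2}\cdots p_t^{n_t}$, where $p_1<p_2<\cdots<p_t$ are such that $n_1\leqslant n_2\leqslant\cdots\leqslant n_t$. Then $$W\bigl(\mathcal{B}(c,L),\,L^{N_0+1}m^{\lceil B\rceil}+1\bigr)>L^{N_0+1}m^{\lceil B\rceil+1}+1,$$ where $N_0=c^4-2c^2+3$ and $B=\frac{\log L}{n_1\log p_1}$.
   Context: $\mathbb{N}=\mathbb{Z}_{\geqslant 0}$. A substitution on a finite alphabet $\mathcal{A}$ is a map $\varrho\colon\mathcal{A}\to\mathcal{A}^+$, extended to words by concatenation. It has constant length $L$ if $|\varrho(a)|=L$ for all $a$; its $i$-th column ($0\leqslant i\leqslant L-1$) is the map $\varrho_i\colon\mathcal{A}\to\mathcal{A}$ sending $a$ to the $i$-th letter of $\varrho(a)$ (indices from $0$). It is bijective if every column is a bijection. It is primitive if some power $\varrho^n$ is such that every $\varrho^n(a)$ contains all letters. A fixed point is $w\in\mathcal{A}^{\mathbb{N}}$ with $\varrho(w)=w$; $\varrho$ is aperiodic if it has no fixed point of the form $v^\infty$ with $v$ a finite word. $\mathcal{B}(c,L)$ is the set of all one-sided fixed points of substitutions $\varrho$ of constant length $L$ on a $c$-letter alphabet that are aperiodic, primitive, bijective and satisfy $\varrho_0=\mathrm{id}$. A (finite or infinite) word $x$ contains a monochromatic arithmetic progression of length $M$ if there are a start $j\geqslant0$ and a difference $d\geqslant1$ such that the positions $j,j+d,\dots,j+(M-1)d$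 all lie in $x$ and carry the same letter. $W(\mathcal{B}(c,L),M)$ denotes the smallest positive integer $n$ such that every length-$n$ subword (block of $n$ consecutive letters) of every element of $\mathcal{B}(c,L)$ contains a monochromatic arithmetic progression of length $M$ (such $n$ exists by van der Waerden's theorem). *)

theory Defs
  imports Complex_Main "HOL-Library.Stream" "HOL-Computational_Algebra.Primes"
begin

(* A substitution is represented by its underlying map from letters to words; only its values on
   the alphabet A matter, so every predicate below is relativised to A. *)

definition substitution :: "'a set \<Rightarrow> ('a \<Rightarrow> 'a list) \<Rightarrow> bool" where
  "substitution A \<rho> \<longleftrightarrow> finite A \<and> (\<forall>a\<in>A. \<rho> a \<in> lists A \<and> \<rho> a \<noteq> [])"

definition subst_word :: "('a \<Rightarrow> 'a list) \<Rightarrow> 'a list \<Rightarrow> 'a list" where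
  "subst_word \<rho> u = concat (map \<rho> u)"

(* flat concatenates an infinite sequence of words; it is the infinite concatenation
   only if all these words are nonempty, which holds for a substitution applied to a word over A. *)
definition subst_stream :: "('a \<Rightarrow> 'a list) \<Rightarrow> 'a stream \<Rightarrow> 'a stream" where
  "subst_stream \<rho> w = flat (smap \<rho> w)"

definition constant_length :: "'a set \<Rightarrow> nat \<Rightarrow> ('a \<Rightarrow> 'a list) \<Rightarrow> bool" where
  "constant_length A L \<rho> \<longleftrightarrow> (\<forall>a\<in>A. length (\<rho> a) = L)"

definition column :: "('a \<Rightarrow> 'a list) \<Rightarrow> nat \<Rightarrow> 'a \<Rightarrow> 'a" where
  "column \<rho> i a = \<rho> a ! i"

definition bijective_subst :: "'a set \<Rightarrow> nat \<Rightarrow> ('a \<Rightarrow> 'a list) \<Rightarrow> bool" where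
  "bijective_subst A L \<rho> \<longleftrightarrow> (\<forall>i<L. bij_betw (column \<rho> i) A A)"

definition primitive_subst :: "'a set \<Rightarrow> ('a \<Rightarrow> 'a list) \<Rightarrow> bool" where
  "primitive_subst A \<rho> \<longleftrightarrow> (\<exists>n\<ge>1. \<forall>a\<in>A. A \<subseteq> set ((subst_word \<rho> ^^ n) [a]))"

definition fixed_points :: "'a set \<Rightarrow> ('a \<Rightarrow> 'a list) \<Rightarrow> 'a stream set" where
  "fixed_points A \<rho> = {w \<in> streams A. subst_stream \<rho> w = w}"

definition aperiodic_subst :: "'a set \<Rightarrow> ('a \<Rightarrow> 'a list) \<Rightarrow> bool" where
  "aperiodic_subst A \<rho> \<longleftrightarrow> \<not> (\<exists>v. v \<noteq> [] \<and> cycle v \<in> fixed_points A \<rho>)"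

(* The alphabet with c letters is taken to be {0, ..., c - 1}. *)
definition B_words :: "nat \<Rightarrow> nat \<Rightarrow> nat stream set" where
  "B_words c L = {w. \<exists>\<rho>. substitution {..<c} \<rho> \<and> constant_length {..<c} L \<rho> \<and>
     aperiodic_subst {..<c} \<rho> \<and> primitive_subst {..<c} \<rho> \<and> bijective_subst {..<c} L \<rho> \<and>
     (\<forall>a<c. column \<rho> 0 a = a) \<and> w \<in> fixed_points {..<c} \<rho>}"

definition has_mono_AP :: "'a list \<Rightarrow> nat \<Rightarrow> bool" where
  "has_mono_AP x M \<longleftrightarrow> (\<exists>j d. d \<ge> 1 \<and>
     (\<exists>a. \<forall>k<M. j + k * d < length x \<and> x ! (j + k * d) = a))"

definition vdW_number :: "'a stream set \<Rightarrow> nat \<Rightarrow> nat" where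
  "vdW_number X M = (LEAST n. n \<ge> 1 \<and> (\<forall>w\<in>X. \<forall>i. has_mono_AP (stake n (sdrop i w)) M))"

end

(* The word counting the digits L - 1 of n in base L, modulo c, lies in B(c, L). Let
   q = p_1 ^ n_1 and q ^ (k - 1) < m <= q ^ k. For every d <= m, comparing prime powers shows that
   gcd d (L ^ (k + 2)) divides L ^ k, so a progression of difference d contains, among any
   L ^ (k + 2) consecutive terms, one at which adding d causes a prescribed carry and changes the
   letter. As q powr B = L gives L ^ (k - 1) <= m powr B, a window of length D m + 1 with
   D = L ^ (N0 + 1) * m ^ ceiling B, where only d <= m is possible, has no monochromatic
   progression of length D + 1.
   Since vdW_number is a LEAST, it must also be shown that some window length works. For bijective
   substitutions this needs no van der Waerden theorem: repeating a digit block c! times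
   applies the identity permutation. *)

theory Submission
  imports Defs "HOL-Number_Theory.Cong"
begin

section \<open>Fixed points of constant-length substitutions\<close>

text \<open>Every image has length \<open>L\<close>, so peeling one block off \<open>flat\<close>
  shifts indices by \<open>L\<close>; \<open>i < L\<close> forces \<open>L > 0\<close>, hence
  nonempty blocks, which unfolding \<open>flat\<close> requires.\<close>

lemma snth_subst_stream:
  assumes "constant_length A L \<rho>" "w \<in> streams A" "i < L"
  shows "subst_stream \<rho> w !! (L * n + i) = column \<rho> i (w !! n)"
  using assms(2)
proof (induction n arbitrary: w)
  have unfold: "flat (smap \<rho> w) = \<rho> (shd w) @- flat (smap \<rho> (stl w))"
    and len: "length (\<rho> (shd w)) = L" if "w \<in> streams A" for w
  proof -
    have "shd w \<in> A" using that by (metis stream.collapse streams_Stream)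
    then show len: "length (\<rho> (shd w)) = L" using assms(1) by (simp add: constant_length_def)
    then have "\<rho> (shd w) \<noteq> []" using assms(3) by auto
    then show "flat (smap \<rho> w) = \<rho> (shd w) @- flat (smap \<rho> (stl w))"
      using flat_unfold[of "smap \<rho> w"] by simp
  qed
  {
    case 0
    then show ?case
      using unfold[of w] len[of w] assms(3) by (simp add: subst_stream_def column_def)
  next
    case (Suc n)
    have "stl w \<in> streams A" using Suc.prems by (metis stream.collapse streams_Stream)
    then have IH: "flat (smap \<rho> (stl w)) !! (L * n + i) = column \<rho> i (stl w !! n)"
      using Suc.IH by (simp add: subst_stream_def)
    have "flat (smap \<rho> w) !! (L * Suc n + i) = flat (smap \<rho> (stl w)) !! (L * n + i)"
      using unfold[OF Suc.prems] len[OF Suc.prems] by simp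
    then show ?case using IH by (simp add: subst_stream_def)
  }
qed

lemma fixed_point_snth:
  assumes "constant_length A L \<rho>" "w \<in> fixed_points A \<rho>" "i < L"
  shows "w !! (L * n + i) = column \<rho> i (w !! n)"
  using snth_subst_stream[OF assms(1) _ assms(3), of w n] assms(2) by (simp add: fixed_points_def)

lemma fixed_pointI:
  assumes "constant_length A L \<rho>" "w \<in> streams A" "L > 0"
    and "\<And>n i. i < L \<Longrightarrow> w !! (L * n + i) = column \<rho> i (w !! n)"
  shows "w \<in> fixed_points A \<rho>"
proof -
  have "subst_stream \<rho> w !! N = w !! N" for N
    using snth_subst_stream[OF assms(1,2), of "N mod L" "N div L"] assms(4)[of "N mod L" "N div L"] assms(3)
    by simp
  then have "subst_stream \<rho> w = w" using smap_alt[of id "subst_stream \<rho> w" w] by (simp add: stream.map_id)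
  then show ?thesis using assms(2) by (simp add: fixed_points_def)
qed

section \<open>Long monochromatic progressions exist\<close>

text \<open>Among the \<open>c + 1\<close> iterates of \<open>a\<close> indexed by
  \<open>{..c}\<close> two coincide. Injectivity cancels the common part, leaving a period
  \<open>e <= c\<close>, which divides \<open>fact c\<close>.\<close>

lemma funpow_fact_id:
  assumes "bij_betw f A A" "finite A" "card A \<le> c" "a \<in> A"
  shows "(f ^^ fact c) a = a"
proof -
  have bij: "bij_betw (f ^^ i) A A" for i
    by (rule bij_betw_funpow[OF assms(1)])
  have "(\<lambda>i. (f ^^ i) a) ` {..c} \<subseteq> A"
    using bij assms(4) by (auto simp: bij_betw_def)
  then have "card ((\<lambda>i. (f ^^ i) a) ` {..c}) < card {..c}"
    using card_mono[OF assms(2), of "(\<lambda>i. (f ^^ i) a) ` {..c}"] assms(3) by simp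
  then have "\<not> inj_on (\<lambda>i. (f ^^ i) a) {..c}" using pigeonhole by blast
  then obtain i j where ij: "i < j" "j \<le> c" "(f ^^ i) a = (f ^^ j) a"
    unfolding inj_on_def by (metis atMost_iff linorder_neqE_nat)
  define e where "e = j - i"
  have e: "1 \<le> e" "e \<le> c" "j = i + e" using ij by (auto simp: e_def)
  have "(f ^^ i) ((f ^^ e) a) = (f ^^ i) a" using ij(3) e(3) by (simp add: funpow_add)
  then have fe: "(f ^^ e) a = a"
    using bij[of i] bij[of e] assms(4) unfolding bij_betw_def inj_on_def by blast
  obtain r where r: "fact c = e * r" using dvd_fact[OF e(1,2)] by (auto simp: dvd_def)
  have "((f ^^ e) ^^ r) a = a" by (induction r) (use fe in auto)
  then show ?thesis by (simp add: r funpow_mult mult.commute)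
qed

text \<open>The permutation \<open>g\<close> is the composition of the columns named by the
  \<open>s\<close> base-\<open>L\<close> digits of \<open>t\<close>; the least significant digit
  acts last.\<close>

lemma power_column:
  fixes u :: "nat \<Rightarrow> 'a"
  assumes "\<And>i. i < L \<Longrightarrow> bij_betw (f i) A A"
    and "\<And>n i. i < L \<Longrightarrow> u (L * n + i) = f i (u n)"
    and "t < L ^ s"
  shows "\<exists>g. bij_betw g A A \<and> (\<forall>x. u (L ^ s * x + t) = g (u x))"
  using assms(3)
proof (induction s arbitrary: t)
  case 0
  then show ?case by (intro exI[of _ id]) (auto simp: bij_betw_def)
next
  case (Suc s)
  then have "t div L < L ^ s" by (simp add: less_mult_imp_div_less mult.commute)
  then obtain g where g: "bij_betw g A A" "\<forall>x. u (L ^ s * x + t div L) = g (u x)"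
    using Suc.IH by blast
  have L: "t mod L < L" using Suc.prems by (cases "L = 0") auto
  have "u (L ^ Suc s * x + t) = (f (t mod L) \<circ> g) (u x)" for x
  proof -
    have "L ^ Suc s * x + t = L * (L ^ s * x + t div L) + t mod L"
      by (simp add: algebra_simps)
    then show ?thesis using assms(2)[OF L] g(2) by simp
  qed
  then show ?case using bij_betw_trans[OF g(1) assms(1)[OF L]] by blast
qed

text \<open>Writing the base \<open>L ^ s\<close> digit \<open>t\<close> in each of \<open>c!\<close> places applies the same permutation
  \<open>c!\<close> times, which is the identity; the numbers with such expansions form a progression.\<close>

lemma monochromatic_progression:
  fixes u :: "nat \<Rightarrow> 'a"
  assumes "\<And>i. i < L \<Longrightarrow> bij_betw (f i) A A"
    and "\<And>n i. i < L \<Longrightarrow> u (L * n + i) = f i (u n)"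
    and "finite A" "card A \<le> c" "u x \<in> A" "t < L ^ s"
  shows "u (L ^ (s * fact c) * x + t * (\<Sum>i<fact c. L ^ (s * i))) = u x"
proof -
  obtain g where g: "bij_betw g A A" "\<forall>x. u (L ^ s * x + t) = g (u x)"
    using power_column[OF assms(1,2,6)] by blast
  have "u (L ^ (s * T) * x + t * (\<Sum>i<T. L ^ (s * i))) = (g ^^ T) (u x)" for T
  proof (induction T)
    case (Suc T)
    \<comment> \<open>One more base-\<open>L ^ s\<close> digit \<open>t\<close> is appended at the
      low end, which costs one more application of \<open>g\<close>.\<close>
    have "L ^ (s * Suc T) * x + t * (\<Sum>i<Suc T. L ^ (s * i))
        = L ^ s * (L ^ (s * T) * x + t * (\<Sum>i<T. L ^ (s * i))) + t"
      unfolding sum.lessThan_Suc_shift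
      by (simp add: power_add algebra_simps sum_distrib_left)
    then show ?case using g(2) Suc by simp
  qed simp
  then show ?thesis using funpow_fact_id[OF g(1) assms(3,4,5)] by simp
qed

text \<open>A window of \<open>2 * Q\<close> letters contains a whole aligned block of
  \<open>Q\<close> letters. Taking \<open>s = M\<close> above puts \<open>L ^ M > M\<close> equal
  letters in progression inside that block.\<close>

lemma has_mono_AP_window:
  assumes "w \<in> B_words c L" "L \<ge> 2"
  shows "has_mono_AP (stake (2 * L ^ (M * fact c)) (sdrop i w)) M"
proof -
  obtain \<rho> where \<rho>: "constant_length {..<c} L \<rho>" "bijective_subst {..<c} L \<rho>"
      "w \<in> fixed_points {..<c} \<rho>"
    using assms(1) by (auto simp: B_words_def)
  define Q where "Q = L ^ (M * fact c)"
  define d where "d = (\<Sum>i<fact c. L ^ (M * i))"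
  \<comment> \<open>\<open>Q * x\<close> is the first multiple of \<open>Q\<close> beyond
    \<open>i\<close>.\<close>
  define x where "x = i div Q + 1"
  have "Q > 0" using assms(2) by (simp add: Q_def)
  have "w !! x \<in> {..<c}" using \<rho>(3) by (auto simp: fixed_points_def streams_iff_snth)
  then have mono: "w !! (Q * x + k * d) = w !! x" if "k < L ^ M" for k
    unfolding Q_def d_def
    using monochromatic_progression[of L "column \<rho>" "{..<c}" "snth w" c x k M]
      fixed_point_snth[OF \<rho>(1,3)] \<rho>(2) that
    by (auto simp: bijective_subst_def)
  have "d \<ge> 1"
  proof -
    have "L ^ (M * 0) \<le> d" unfolding d_def by (rule member_le_sum) auto
    then show ?thesis by simp
  qed
  \<comment> \<open>The geometric sum, with terms moved across to avoid subtraction: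
    \<open>(L ^ M - 1) * d = Q - 1\<close>, so the last term is exactly the end of the
    block.\<close>
  have geo: "L ^ M * (\<Sum>i<T. L ^ (M * i)) + 1 = L ^ (M * T) + (\<Sum>i<T. L ^ (M * i))" for T
    by (induction T) (simp_all add: algebra_simps power_add)
  have inside: "k * d < Q" if "k < L ^ M" for k
  proof -
    have "(k + 1) * d \<le> L ^ M * d" using that by (intro mult_right_mono) auto
    then show ?thesis using geo[of "fact c"] by (simp add: d_def[symmetric] Q_def[symmetric])
  qed
  have le: "Q * x \<ge> i" "Q * x \<le> i + Q"
  proof -
    have "Q * (i div Q) + i mod Q = i" by simp
    moreover have "i mod Q < Q" using \<open>Q > 0\<close> by simp
    ultimately show "Q * x \<ge> i" "Q * x \<le> i + Q" unfolding x_def distrib_left mult_1_right by linarith+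
  qed
  have "M < L ^ M" using assms(2) by (simp add: power_gt_expt)
  then have "(Q * x - i) + k * d < length (stake (2 * Q) (sdrop i w)) \<and>
      stake (2 * Q) (sdrop i w) ! ((Q * x - i) + k * d) = w !! x" if "k < M" for k
  proof -
    have k: "k < L ^ M" using that \<open>M < L ^ M\<close> by simp
    have lt: "(Q * x - i) + k * d < 2 * Q" using inside[OF k] le by linarith
    have "i + ((Q * x - i) + k * d) = Q * x + k * d" using le by simp
    then show ?thesis using lt mono[OF k] by (simp add: sdrop_snth add.commute)
  qed
  then show ?thesis unfolding has_mono_AP_def Q_def[symmetric] using \<open>d \<ge> 1\<close> by blast
qed

section \<open>Counting the largest digit\<close>

text \<open>The guard \<open>L < 2\<close> secures termination, since \<open>n div 1 = n\<close>.
  Stopping at 0 is harmless: for \<open>L >= 2\<close> a leading zero is never the digit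
  \<open>L - 1\<close>.\<close>

fun count_top :: "nat \<Rightarrow> nat \<Rightarrow> nat" where
  "count_top L n =
     (if n = 0 \<or> L < 2 then 0 else of_bool (n mod L = L - 1) + count_top L (n div L))"

declare count_top.simps[simp del]

lemma count_top_0 [simp]: "count_top L 0 = 0"
  by (simp add: count_top.simps)

lemma count_top_step:
  assumes "L \<ge> 2" "i < L"
  shows "count_top L (L * n + i) = count_top L n + of_bool (i = L - 1)"
  using assms by (cases "L * n + i = 0") (auto simp: count_top.simps[of L "L * n + i"])

lemma count_top_digit:
  assumes "L \<ge> 2" "i < L"
  shows "count_top L i = of_bool (i = L - 1)"
  using count_top_step[OF assms, of 0] by simp

lemma count_top_append:
  assumes "L \<ge> 2" "s < L ^ k"
  shows "count_top L (L ^ k * x + s) = count_top L x + count_top L s"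
  using assms(2)
proof (induction k arbitrary: s)
  case (Suc k)
  have "s div L < L ^ k" using Suc.prems by (simp add: less_mult_imp_div_less mult.commute)
  note IH = Suc.IH[OF this]
  have L: "s mod L < L" using assms(1) by simp
  have "L ^ Suc k * x + s = L * (L ^ k * x + s div L) + s mod L" by (simp add: algebra_simps)
  then show ?case
    using IH count_top_step[OF assms(1) L, of "L ^ k * x + s div L"]
      count_top_step[OF assms(1) L, of "s div L"] by simp
qed simp

section \<open>Arithmetic progressions modulo powers of the base\<close>

lemma progression_hits_residue:
  fixes j d r N :: nat
  assumes "N > 0" "d > 0" "[r = j] (mod gcd d N)"
  shows "\<exists>i<N. [j + i * d = r] (mod N)"
proof -
  obtain y where y: "[d * y = gcd d N] (mod N)" using cong_solve_nat[of d N] assms(2) by auto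
  \<comment> \<open>\<open>N * j - j\<close> represents \<open>-j\<close> modulo \<open>N\<close>
    without leaving the naturals. Since \<open>r - j\<close> is a multiple of the gcd, the Bezout
    coefficient \<open>y\<close> scales to the index \<open>y * z mod N\<close>.\<close>
  have "gcd d N dvd r + (N * j - j)"
  proof -
    have "[r + (N * j - j) = j + (N * j - j)] (mod gcd d N)" using assms(3) by (rule cong_add_rcancel_nat[THEN iffD2])
    moreover have "j + (N * j - j) = N * j" using assms(1) by (cases N) auto
    ultimately have "[r + (N * j - j) = N * j] (mod gcd d N)" by simp
    moreover have "gcd d N dvd N * j" by simp
    ultimately show ?thesis by (metis cong_dvd_iff)
  qed
  then obtain z where z: "r + (N * j - j) = gcd d N * z" by (auto simp: dvd_def)
  have "[d * y * z = gcd d N * z] (mod N)" using y by (rule cong_scalar_right)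
  then have "[j + d * y * z = j + (r + (N * j - j))] (mod N)" using z by (simp add: cong_add_lcancel_nat)
  moreover have "j + (r + (N * j - j)) = r + N * j" using assms(1) by (cases N) auto
  ultimately have 1: "[j + d * y * z = r] (mod N)" by (simp add: cong_def)
  have "[j + (y * z mod N) * d = j + d * y * z] (mod N)"
    unfolding mult.assoc mult.commute[of _ d] by (intro cong_add cong_mult) (simp_all add: cong_def)
  then show ?thesis using 1 assms(1) by (meson cong_trans mod_less_divisor)
qed

text \<open>A progression meets some \<open>s\<close> just below \<open>L ^ k\<close> whose successor \<open>s + d = L ^ k + v\<close> only
  carries into the next digit. Prescribing that digit in two ways changes the digit count by
  amounts that cannot both vanish modulo \<open>c\<close>.\<close>

lemma count_top_changes:
  fixes c d j k L :: nat
  assumes c: "c \<ge> 2" and L: "L \<ge> 2" and d: "d > 0" "d \<le> L ^ k"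
    and g: "gcd d (L ^ (k + 2)) dvd L ^ k"
  shows "\<exists>i<L ^ (k + 2). \<not> [count_top L (j + i * d) = count_top L (j + Suc i * d)] (mod c)"
proof (rule ccontr)
  assume "\<not> ?thesis"
  then have const: "[count_top L (j + i * d) = count_top L (j + i * d + d)] (mod c)"
    if "i < L ^ (k + 2)" for i
    using that by (auto simp: algebra_simps)
  define G where "G = gcd d (L ^ (k + 2))"
  have G: "G > 0" "G \<le> d" "G dvd L ^ k" using d g by (auto simp: G_def gcd_le1_nat)
  \<comment> \<open>The largest number below \<open>L ^ k\<close> congruent to \<open>j\<close>
    modulo \<open>G\<close>. It is at least \<open>L ^ k - G\<close>, and
    \<open>G <= d <= L ^ k\<close>, so adding \<open>d\<close> carries exactly 1.\<close>
  define s where "s = L ^ k - G + j mod G"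
  define v where "v = s + d - L ^ k"
  have jG: "j mod G < G" using G by simp
  have s: "s < L ^ k" "s + d = L ^ k + v" "v < L ^ k"
    using G d jG unfolding s_def v_def by linarith+
  have "[L ^ k - G + j mod G = 0 + j] (mod G)"
    by (intro cong_add) (use G in \<open>auto simp: cong_0_iff cong_def\<close>)
  then have sG: "[s = j] (mod G)" by (simp add: s_def)
  \<comment> \<open>Some term ends in the digits of \<open>a\<close> followed by those of
    \<open>s\<close>; the next one ends in \<open>b\<close>, then \<open>v\<close>. Two digits are
    reserved for \<open>a\<close> and \<open>b\<close> because the binary case needs
    \<open>b = 2\<close>.\<close>
  have key: "[count_top L a + count_top L s = count_top L b + count_top L v] (mod c)"
    if ab: "b = a + 1" "b < L ^ 2" for a b
  proof -
    have bound: "L ^ k * a + s < L ^ (k + 2)"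
    proof -
      have "L ^ k * a + s < L ^ k * (a + 1)" using s by simp
      also have "\<dots> \<le> L ^ k * L ^ 2" using ab by (intro mult_left_mono) auto
      finally show ?thesis unfolding power_add .
    qed
    have bound': "L ^ k * b + v < L ^ (k + 2)"
    proof -
      have "L ^ k * b + v < L ^ k * (b + 1)" using s by simp
      also have "\<dots> \<le> L ^ k * L ^ 2" using ab by (intro mult_left_mono) auto
      finally show ?thesis unfolding power_add .
    qed
    have "G dvd L ^ k * a" using G by simp
    then have "[L ^ k * a + s = 0 + j] (mod G)"
      by (intro cong_add sG) (simp add: cong_0_iff)
    then obtain i where i: "i < L ^ (k + 2)" "[j + i * d = L ^ k * a + s] (mod L ^ (k + 2))"
      using progression_hits_residue[of "L ^ (k + 2)" d "L ^ k * a + s" j] L d unfolding G_def by auto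
    define x where "x = (j + i * d) div L ^ (k + 2)"
    have "(j + i * d) mod L ^ (k + 2) = L ^ k * a + s" using i(2) bound by (simp add: cong_def)
    then have n: "j + i * d = L ^ (k + 2) * x + (L ^ k * a + s)"
      unfolding x_def by (metis mult_div_mod_eq)
    have n': "j + i * d + d = L ^ (k + 2) * x + (L ^ k * b + v)"
      using n s(2) ab(1) by (simp add: algebra_simps)
    have "[count_top L x + (count_top L a + count_top L s)
        = count_top L x + (count_top L b + count_top L v)] (mod c)"
      using const[OF i(1)] unfolding n' unfolding n
      by (simp only: count_top_append[OF L bound] count_top_append[OF L bound']
          count_top_append[OF L s(1)] count_top_append[OF L s(3)])
    then show ?thesis by (simp add: cong_add_lcancel_nat)
  qed
  have no: "\<not> [a = Suc a] (mod c)" for a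
    using c cong_add_lcancel_nat[of a 0 1 c] by (auto simp: cong_def)
  have L2: "L < L ^ 2" using L by (simp add: power2_eq_square)
  show False
  \<comment> \<open>In base 2, the carry from 0 to 1 adds a top digit while 01 to 10 adds none. In
    larger bases, 0 to 1 adds none while \<open>L - 2\<close> to \<open>L - 1\<close> adds one.
    Either way \<open>s\<close> and \<open>v\<close> would satisfy two congruences differing by
    1.\<close>
  proof (cases "L = 2")
    case True
    have "[count_top L s = Suc (count_top L v)] (mod c)"
      using key[of 1 0] True by (simp add: count_top_digit)
    moreover have "[Suc (count_top L s) = Suc (count_top L v)] (mod c)"
      using key[of 2 1] True count_top_step[of 2 0 1] by (simp add: count_top_digit)
    ultimately have "[count_top L s = Suc (count_top L s)] (mod c)"
      by (meson cong_sym cong_trans)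
    then show ?thesis using no by blast
  next
    case False
    then have L3: "L \<ge> 3" using L by simp
    then have digits: "Suc 0 \<noteq> L - Suc 0" "L - 2 \<noteq> L - 1" "Suc (L - 2) = L - 1"
      by linarith+
    have "[count_top L s = count_top L v] (mod c)"
      using key[of 1 0] L3 L2 digits by (simp add: count_top_digit)
    moreover have "[count_top L s = Suc (count_top L v)] (mod c)"
      using key[of "L - 1" "L - 2"] L3 L2 digits by (simp add: count_top_digit)
    ultimately show ?thesis using no by (meson cong_sym cong_trans)
  qed
qed

text \<open>If \<open>p\<close> divides \<open>L\<close> and \<open>p ^ v\<close> divides
  \<open>d\<close>, then \<open>p ^ v <= d <= q ^ k <= p ^ (e * k)\<close>, so
  \<open>v <= e * k\<close>, and \<open>p ^ (e * k)\<close> divides \<open>L ^ k\<close>. Other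
  primes do not divide the gcd.\<close>

lemma gcd_power_dvd_power:
  fixes L d q k r :: nat
  assumes "\<And>p. prime p \<Longrightarrow> p dvd L \<Longrightarrow> \<exists>e. q \<le> p ^ e \<and> p ^ e dvd L"
    and "L > 0" "d > 0" "d \<le> q ^ k"
  shows "gcd d (L ^ r) dvd L ^ k"
proof (rule multiplicity_le_imp_dvd)
  show "gcd d (L ^ r) \<noteq> 0" using assms(3) by simp
  fix p :: nat
  assume p: "prime p"
  show "multiplicity p (gcd d (L ^ r)) \<le> multiplicity p (L ^ k)"
  proof (cases "p dvd L")
    case True
    then obtain e where e: "q \<le> p ^ e" "p ^ e dvd L" using assms(1) p by blast
    define v where "v = multiplicity p (gcd d (L ^ r))"
    have "p ^ v dvd d" using multiplicity_dvd[of p "gcd d (L ^ r)"] unfolding v_def by auto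
    then have "p ^ v \<le> d" using assms(3) by (rule dvd_imp_le)
    also have "\<dots> \<le> (p ^ e) ^ k" using assms(4) power_mono[OF e(1), of k] by simp
    finally have "v \<le> e * k" using prime_gt_1_nat[OF p] by (simp add: power_mult[symmetric])
    moreover have "p ^ (e * k) dvd L ^ k" using e(2) by (simp add: power_mult dvd_power_same)
    ultimately have "p ^ v dvd L ^ k" by (meson dvd_trans le_imp_power_dvd)
    then show ?thesis
      using assms(2) p unfolding v_def by (intro multiplicity_geI) auto
  next
    case False
    then have "\<not> p dvd gcd d (L ^ r)" using p prime_dvd_power by auto
    then show ?thesis by (simp add: not_dvd_imp_multiplicity_0)
  qed
qed

section \<open>A substitution with short progressions\<close>

text \<open>For \<open>c = L = 2\<close> this is the Thue-Morse substitution.\<close>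

definition top_subst :: "nat \<Rightarrow> nat \<Rightarrow> nat \<Rightarrow> nat list" where
  "top_subst c L a = map (\<lambda>i. if i = L - 1 then Suc a mod c else a) [0..<L]"

lemma column_top_subst:
  "i < L \<Longrightarrow> column (top_subst c L) i a = (if i = L - 1 then Suc a mod c else a)"
  by (simp add: column_def top_subst_def)

lemma constant_length_top_subst: "constant_length A L (top_subst c L)"
  by (simp add: constant_length_def top_subst_def)

lemma substitution_top_subst:
  assumes "c > 0" "L > 0"
  shows "substitution {..<c} (top_subst c L)"
  using assms by (auto simp: substitution_def top_subst_def)

lemma bijective_top_subst: "bijective_subst {..<c} L (top_subst c L)"
proof -
  have "bij_betw (\<lambda>a. Suc a mod c) {..<c} {..<c}"
  proof (rule bij_betw_imageI)
    show inj: "inj_on (\<lambda>a. Suc a mod c) {..<c}"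
      by (auto simp: inj_on_def mod_Suc split: if_splits)
    show "(\<lambda>a. Suc a mod c) ` {..<c} = {..<c}"
      by (rule endo_inj_surj[OF _ _ inj]) auto
  qed
  moreover have "bij_betw (\<lambda>a. a) {..<c} {..<c}" by (simp add: bij_betw_def)
  moreover have "column (top_subst c L) i
      = (if i = L - 1 then \<lambda>a. Suc a mod c else (\<lambda>a. a))" if "i < L" for i
    using that by (auto simp: column_top_subst)
  ultimately show ?thesis by (simp add: bijective_subst_def)
qed

lemma primitive_top_subst:
  assumes "c > 0" "L \<ge> 2"
  shows "primitive_subst {..<c} (top_subst c L)"
proof -
  have step: "b \<in> set (top_subst c L b)" "Suc b mod c \<in> set (top_subst c L b)" for b
  proof -
    have "top_subst c L b ! 0 = b" "top_subst c L b ! (L - 1) = Suc b mod c"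
      and "length (top_subst c L b) = L"
      using assms(2) by (auto simp: top_subst_def)
    then show "b \<in> set (top_subst c L b)" "Suc b mod c \<in> set (top_subst c L b)"
      using assms(2) nth_mem[of 0 "top_subst c L b"] nth_mem[of "L - 1" "top_subst c L b"] by auto
  qed
  have set_subst_word: "set (subst_word (top_subst c L) u) = (\<Union>b\<in>set u. set (top_subst c L b))" for u
    by (simp add: subst_word_def)
  have mem: "(a + i) mod c \<in> set ((subst_word (top_subst c L) ^^ n) [a])" if "a < c" "i \<le> n" for a i n
    using that(2)
  proof (induction n arbitrary: i)
    case 0
    then show ?case using that(1) by simp
  next
    case (Suc n)
    show ?case
    proof (cases "i = Suc n")
      case True
      have "(a + n) mod c \<in> set ((subst_word (top_subst c L) ^^ n) [a])" using Suc.IH by simp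
      then show ?thesis using step(2)[of "(a + n) mod c"] True
        by (auto simp: set_subst_word mod_Suc_eq)
    next
      case False
      then have "(a + i) mod c \<in> set ((subst_word (top_subst c L) ^^ n) [a])"
        using Suc by simp
      then show ?thesis using step(1) by (auto simp: set_subst_word)
    qed
  qed
  \<comment> \<open>The shift \<open>c - a + b\<close> is \<open>b - a\<close> modulo
    \<open>c\<close>, kept nonnegative; it is below \<open>2 * c\<close>.\<close>
  have "b \<in> set ((subst_word (top_subst c L) ^^ (2 * c)) [a])" if "a < c" "b < c" for a b
    using mem[of a "c - a + b" "2 * c"] that by simp
  then show ?thesis unfolding primitive_subst_def
    using assms(1) by (intro exI[of _ "2 * c"]) auto
qed

text \<open>The first letter stays arbitrary because aperiodicity concerns every fixed point, not
  only \<open>top_word\<close>.\<close>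

lemma fixed_point_top_subst:
  assumes "L \<ge> 2" "w \<in> fixed_points {..<c} (top_subst c L)"
  shows "w !! n = (w !! 0 + count_top L n) mod c"
proof (induction n rule: less_induct)
  case (less n)
  have lt: "w !! i < c" for i using assms(2) by (auto simp: fixed_points_def streams_iff_snth)
  show ?case
  proof (cases "n = 0")
    case True
    then show ?thesis using lt[of 0] by simp
  next
    case False
    have i: "n mod L < L" using assms(1) by simp
    have IH: "w !! (n div L) = (w !! 0 + count_top L (n div L)) mod c"
      using less False assms(1) by simp
    have "w !! n = (if n mod L = L - 1 then Suc (w !! (n div L)) mod c else w !! (n div L))"
      using fixed_point_snth[OF constant_length_top_subst assms(2) i, of "n div L"]
      by (simp add: column_top_subst[OF i])
    moreover have "count_top L n = count_top L (n div L) + of_bool (n mod L = L - 1)"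
      using count_top_step[OF assms(1) i, of "n div L"] by simp
    ultimately show ?thesis using IH by (auto simp: mod_Suc_eq)
  qed
qed

text \<open>Serves twice: with \<open>d\<close> a supposed period for aperiodicity, and with
  \<open>d <= m\<close> for the lower bound.\<close>

lemma fixed_point_top_subst_changes:
  assumes "c \<ge> 2" "L \<ge> 2" "w \<in> fixed_points {..<c} (top_subst c L)"
    and "d > 0" "d \<le> q ^ k" "q \<le> L"
    and "\<And>p. prime p \<Longrightarrow> p dvd L \<Longrightarrow> \<exists>e. q \<le> p ^ e \<and> p ^ e dvd L"
  shows "\<exists>i<L ^ (k + 2). w !! (j + i * d) \<noteq> w !! (j + Suc i * d)"
proof -
  have "d \<le> L ^ k" using assms(5) power_mono[OF assms(6), of k] by simp
  moreover have "gcd d (L ^ (k + 2)) dvd L ^ k"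
    using gcd_power_dvd_power[OF assms(7)] assms(2,4,5) by (simp del: power_Suc add_2_eq_Suc')
  ultimately obtain i where i: "i < L ^ (k + 2)"
      "\<not> [count_top L (j + i * d) = count_top L (j + Suc i * d)] (mod c)"
    using count_top_changes[OF assms(1,2,4)] by blast
  have "w !! (j + i * d) \<noteq> w !! (j + Suc i * d)"
  proof
    assume "w !! (j + i * d) = w !! (j + Suc i * d)"
    then have "[w !! 0 + count_top L (j + i * d) = w !! 0 + count_top L (j + Suc i * d)] (mod c)"
      using fixed_point_top_subst[OF assms(2,3)] unfolding cong_def by metis
    then show False using i(2) by (simp only: cong_add_lcancel_nat)
  qed
  then show ?thesis using i(1) by blast
qed

lemma aperiodic_top_subst:
  assumes "c \<ge> 2" "L \<ge> 2"
  shows "aperiodic_subst {..<c} (top_subst c L)"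
  unfolding aperiodic_subst_def
proof
  assume "\<exists>v. v \<noteq> [] \<and> cycle v \<in> fixed_points {..<c} (top_subst c L)"
  then obtain v where v: "v \<noteq> []" "cycle v \<in> fixed_points {..<c} (top_subst c L)" by blast
  have per: "cycle v !! (n + length v) = cycle v !! n" for n
    using cycle_decomp[OF v(1)] shift_snth_ge[of v "n + length v" "cycle v"] by simp
  \<comment> \<open>Every prime is at least 2, so \<open>q = 2\<close> with \<open>e = 1\<close> is
    admissible for any \<open>L\<close>; the exponent \<open>k = length v\<close> then covers the
    difference \<open>length v\<close>.\<close>
  have "\<exists>e. 2 \<le> p ^ e \<and> p ^ e dvd L" if "prime p" "p dvd L" for p
    using that prime_ge_2_nat by (intro exI[of _ 1]) auto
  moreover have "length v \<le> 2 ^ length v" by (simp add: less_imp_le)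
  ultimately obtain i where "cycle v !! (0 + i * length v) \<noteq> cycle v !! (0 + Suc i * length v)"
    using fixed_point_top_subst_changes[OF assms v(2), of "length v" 2 "length v" 0] v(1) assms by auto
  then show False using per[of "i * length v"] by (simp add: add.commute)
qed

definition top_word :: "nat \<Rightarrow> nat \<Rightarrow> nat stream" where
  "top_word c L = smap (\<lambda>n. count_top L n mod c) nats"

lemma fixed_point_top_word:
  assumes "c > 0" "L \<ge> 2"
  shows "top_word c L \<in> fixed_points {..<c} (top_subst c L)"
proof (rule fixed_pointI[OF constant_length_top_subst])
  show "top_word c L \<in> streams {..<c}" using assms by (simp add: top_word_def streams_iff_snth)
  show "L > 0" using assms by simp
  fix n i
  assume "i < L"
  then show "top_word c L !! (L * n + i) = column (top_subst c L) i (top_word c L !! n)"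
    using assms by (simp add: top_word_def column_top_subst count_top_step mod_Suc_eq)
qed

lemma top_word_in_B_words:
  assumes "c \<ge> 2" "L \<ge> 2"
  shows "top_word c L \<in> B_words c L"
  unfolding B_words_def
  using assms substitution_top_subst[of c L] constant_length_top_subst[of "{..<c}" L c]
    aperiodic_top_subst[of c L] primitive_top_subst[of c L] bijective_top_subst[of c L]
    fixed_point_top_word[of c L]
  by (auto intro!: exI[of _ "top_subst c L"] simp: column_top_subst)

section \<open>The lower bound\<close>

lemma vdW_number_B_words_gt:
  assumes "c \<ge> 2" "L \<ge> 2" "m \<le> q ^ k" "q \<le> L" "L ^ (k + 2) \<le> D"
    and "\<And>p. prime p \<Longrightarrow> p dvd L \<Longrightarrow> \<exists>e. q \<le> p ^ e \<and> p ^ e dvd L"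
  shows "vdW_number (B_words c L) (D + 1) > D * m + 1"
proof -
  define P where "P n \<longleftrightarrow> n \<ge> 1 \<and>
      (\<forall>w\<in>B_words c L. \<forall>i. has_mono_AP (stake n (sdrop i w)) (D + 1))" for n
  define V where "V = vdW_number (B_words c L) (D + 1)"
  have "P (2 * L ^ ((D + 1) * fact c))"
    unfolding P_def
  proof (intro conjI ballI allI)
    show "1 \<le> 2 * L ^ ((D + 1) * fact c)" using assms(2) by (simp add: Suc_leI)
  qed (rule has_mono_AP_window[OF _ assms(2)])
  then have "P V" unfolding V_def vdW_number_def P_def by (rule LeastI)
  then have "has_mono_AP (stake V (sdrop 0 (top_word c L))) (D + 1)"
    using top_word_in_B_words[OF assms(1,2)] unfolding P_def by blast
  then obtain j d a where d: "d \<ge> 1"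
    and AP: "\<And>i. i < D + 1 \<Longrightarrow> j + i * d < V \<and> stake V (top_word c L) ! (j + i * d) = a"
    by (auto simp: has_mono_AP_def)
  have const: "top_word c L !! (j + i * d) = a" if "i \<le> D" for i
    using AP[of i] that by auto
  show ?thesis
  proof (rule ccontr)
    assume "\<not> ?thesis"
    then have "V \<le> D * m + 1" by (simp add: V_def)
    moreover have "j + D * d < V" using AP[of D] by simp
    \<comment> \<open>\<open>D + 1\<close> terms span \<open>D * d\<close>, which must fit among the
      first \<open>D * m + 1\<close> letters; this forces \<open>d <= m\<close>.\<close>
    ultimately have "D * d \<le> D * m" by linarith
    moreover have "D > 0" using assms(2,5) by (metis gr0I le_zero_eq not_numeral_le_zero power_not_zero)
    ultimately have "d \<le> q ^ k" using assms(3) by simp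
    moreover have "d > 0" using d by simp
    moreover have "top_word c L \<in> fixed_points {..<c} (top_subst c L)"
      using fixed_point_top_word assms(1,2) by simp
    ultimately obtain i where "i < L ^ (k + 2)"
        "top_word c L !! (j + i * d) \<noteq> top_word c L !! (j + Suc i * d)"
      using fixed_point_top_subst_changes[OF assms(1,2) _ _ _ assms(4,6)] by blast
    \<comment> \<open>As \<open>i < L ^ (k + 2) <= D\<close>, both \<open>i\<close> and
      \<open>Suc i\<close> index terms of the progression.\<close>
    then show False using const[of i] const[of "Suc i"] assms(5) by simp
  qed
qed

theorem corollary28:
  fixes c m L t :: nat and p n :: "nat \<Rightarrow> nat"
  assumes "c > 1" and "m > 1" and "L \<ge> 2"
    and "\<forall>i\<in>{1..t}. prime (p i) \<and> n i \<ge> 1"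
    and "L = (\<Prod>i=1..t. p i ^ n i)"
    and "strict_mono_on {1..t} p"
    and "mono_on {1..t} n"
  defines "N0 \<equiv> c ^ 4 - 2 * c ^ 2 + 3"
    and "B \<equiv> ln (real L) / (real (n 1) * ln (real (p 1)))"
  shows "vdW_number (B_words c L) (L ^ (N0 + 1) * m ^ nat \<lceil>B\<rceil> + 1)
           > L ^ (N0 + 1) * m ^ (nat \<lceil>B\<rceil> + 1) + 1"
proof -
  have t: "t \<ge> 1" using assms(3,5) by (cases "t = 0") auto
  define q where "q = p 1 ^ n 1"
  have p1: "prime (p 1)" "n 1 \<ge> 1" using assms(4) t by auto
  have q: "q \<ge> 2"
    using prime_ge_2_nat[OF p1(1)] self_le_power[of "p 1" "n 1"] p1(2) unfolding q_def by linarith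
  have dvd: "p i ^ n i dvd L" if "i \<in> {1..t}" for i
    unfolding assms(5) using that by (intro dvd_prodI) auto
  have "q \<le> L" using dvd[of 1] t assms(3) unfolding q_def by (intro dvd_imp_le) auto
  \<comment> \<open>Both \<open>p\<close> and \<open>n\<close> are smallest at index 1, so
    \<open>q\<close> is the least of the prime powers \<open>p i ^ n i\<close>.\<close>
  have primes: "\<exists>e. q \<le> r ^ e \<and> r ^ e dvd L" if r: "prime r" "r dvd L" for r
  proof -
    obtain i where i: "i \<in> {1..t}" "r dvd p i ^ n i"
      using r unfolding assms(5) by (auto simp: prime_dvd_prod_iff)
    then have "r = p i" using r(1) assms(4) by (meson prime_dvd_power primes_dvd_imp_eq)
    have "p 1 \<le> p i"
      using i(1) t assms(6) by (auto intro: monotone_onD[OF strict_mono_on_imp_mono_on])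
    moreover have "n 1 \<le> n i" using i(1) t assms(7) by (auto intro: monotone_onD)
    moreover have "p 1 \<ge> 1" using prime_gt_0_nat[OF p1(1)] by simp
    ultimately have "q \<le> p i ^ n i"
      unfolding q_def by (intro order_trans[OF power_mono power_increasing]) auto
    then show ?thesis using dvd[OF i(1)] \<open>r = p i\<close> by blast
  qed
  \<comment> \<open>\<open>Suc l\<close> is the least exponent at which powers of \<open>q\<close>
    reach \<open>m\<close>; it is positive since \<open>m > 1\<close>.\<close>
  obtain l where l: "q ^ l < m" "m \<le> q ^ Suc l"
  proof -
    define k where "k = (LEAST k. m \<le> q ^ k)"
    have "m < 2 ^ m" by simp
    also have "(2::nat) ^ m \<le> q ^ m" using q by (rule power_mono) simp
    finally have "m \<le> q ^ m" by simp
    then have k: "m \<le> q ^ k" unfolding k_def by (rule LeastI)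
    have "k \<noteq> 0" using k assms(2) by (cases k) auto
    then obtain l where "k = Suc l" by (cases k) auto
    then have "\<not> m \<le> q ^ l" using not_less_Least[of l "\<lambda>k. m \<le> q ^ k"] by (simp add: k_def)
    then show ?thesis using that[of l] k \<open>k = Suc l\<close> by simp
  qed
  \<comment> \<open>\<open>B\<close> is the logarithm of \<open>L\<close> to base \<open>q\<close>,
    so \<open>L ^ l\<close> is the \<open>B\<close>-th power of \<open>q ^ l < m\<close>. Logarithms
    handle the real exponent.\<close>
  have "L ^ l \<le> m ^ nat \<lceil>B\<rceil>"
  proof -
    have lnq: "ln (real q) = real (n 1) * ln (real (p 1))"
      using prime_gt_0_nat[OF p1(1)] by (simp add: q_def ln_realpow)
    have "ln (real q) > 0" using q by simp
    then have BL: "B * ln (real q) = ln (real L)" unfolding B_def lnq[symmetric] by simp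
    have "B \<ge> 0" unfolding B_def lnq[symmetric] using q assms(3) by simp
    have "ln (real (L ^ l)) = B * ln (real (q ^ l))"
      using assms(3) q BL by (simp add: ln_realpow mult.left_commute)
    also have "\<dots> \<le> B * ln (real m)"
      using l(1) q \<open>B \<ge> 0\<close> by (intro mult_left_mono) auto
    also have "\<dots> \<le> real (nat \<lceil>B\<rceil>) * ln (real m)"
      using assms(2) by (intro mult_right_mono) (auto simp: real_nat_ceiling_ge)
    also have "\<dots> = ln (real (m ^ nat \<lceil>B\<rceil>))"
      using assms(2) by (simp add: ln_realpow)
    finally have "real (L ^ l) \<le> real (m ^ nat \<lceil>B\<rceil>)"
      using assms(2,3) by (subst (asm) ln_le_cancel_iff) auto
    then show ?thesis by (simp only: of_nat_le_iff)
  qed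
  then have "L ^ (N0 + 1) * L ^ l \<le> L ^ (N0 + 1) * m ^ nat \<lceil>B\<rceil>" by simp
  \<comment> \<open>\<open>N0 >= 3\<close> holds even with truncated subtraction, so
    \<open>Suc l + 2 <= N0 + 1 + l\<close>.\<close>
  moreover have "L ^ (Suc l + 2) \<le> L ^ (N0 + 1) * L ^ l"
    unfolding power_add[symmetric] using assms(3) by (intro power_increasing) (auto simp: N0_def)
  ultimately have D: "L ^ (Suc l + 2) \<le> L ^ (N0 + 1) * m ^ nat \<lceil>B\<rceil>" by linarith
  have "c \<ge> 2" using assms(1) by simp
  from vdW_number_B_words_gt[OF this assms(3) l(2) \<open>q \<le> L\<close> D primes]
  show ?thesis by (simp only: power_add[of m] power_one_right mult.assoc)
qed

end
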